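(* Let $T$ be a regular tree of degree $d\ge 3$ rooted at a vertex $v_0$, and let $D\ge 1$ be a natural number. There is a constant $C$ depending only on $D$ and $T$ such that every $D$-deep mixed-subtree quasi-isometry $f:T\to T$ (that is, every map $f$ produced by the construction recalled in the context, for any choice of the functions $f_v'$) is an order-preserving $C$-quasi-isometry.
   Context: Trees. Trees have edges of length exactly $1$, and $d(\cdot,\cdot)$ is the path metric; maps $T\to T$ are regarded as maps on the vertex set. A regular tree of degree $d$ is a tree in which every vertex (including the root) has exactly $d$ neighbours ($d$ finite). Let $T$ be a tree rooted at $v_0$. A vertex $v$ is a descendant of $w$ (and $w$ an ancestor of $v$) if $w$ lies on the geodesic from $v_0$ to $v$ (so $w$ is a descendant of itself); $T_w$ denotes the subtree of all descendants of $w$, and $T_w^k=\{v\in T_w : d(w,v)\le k\}$. A vertex $v\in T_w$ with $d(v,w)=D$ is a $D$-child of $w$. The parent $p(v)$ of $v\neq v_0$ is the neighbour of $v$ on the geodesic to $v_0$, and $p(v_0)=v_0$. For a finite subtree $S$ of $T$, the boundary $\partial S$ is the set of vertices $v\in T\setminus S$ with $p(v)\in S$. A map $f:T\to T$ is order-preserving if for all vertices $u,v\in T$ with $v\in T_u$ we have $f(v)\in T_{f(u)}$. Quasi-isometries. For a metric space $(X,d)$ and $C\ge 1$, a map $f:X\to X$ is a $C$-quasi-isometry if $\frac{d(x,y)}{C}-C\le d(f(x),f(y))\le C\,d(x,y)+C$ for all $x,y\in X$, and there exists some constant $D'$ such that every $y\in X$ satisfies $d(y,f(x))\le D'$ for some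 $x\in X$. $D$-deep mixed-subtree quasi-isometries (this is only a name for the maps constructed here). Let $T$ be a regular tree of degree $d\ge 3$ rooted at $v_0$ and let $D\ge 1$ be a natural number. Inductively construct functions $f_i:T_{v_0}^{iD}\to T$, $i\ge 0$, as follows. Set $f_0(v_0)=v_0$. Given $f_i$, define $f_{i+1}$ by: $f_{i+1}(x)=f_i(x)$ for $x\in T_{v_0}^{iD}$; and for every vertex $v$ of the form $v=f_i(x)$ with $d(v_0,x)=iD$, let $X=\{x_1,\dots,x_k\}$ be the set of all vertices $x_j$ with $d(v_0,x_j)=iD$ and $f_i(x_j)=v$, let $B_v$ be the set of all $D$-children of vertices in $X$, and choose any function $f_v':B_v\to T_v$ such that (1) $\mathrm{Im}(f_v')=\partial S_v$ for some finite subtree $S_v$ of $T_v$ containing $v$; and (2) if $f_v'(w)=f_v'(w')$, then $w$ and $w'$ are $D$-children of the same vertex $x_j\in X$. Then set $f_{i+1}|_{B_v}=f_v'$, and $f_{i+1}(w)=v$ for all $w\in T_{x_j}^{D-1}$ and all $x_j\in X$. (The choice of $f_v'$ is made separately at each stage $i$.) The functions $f_i$ agree on common domains, so they define a map $f:T\to T$. Any map $f$ obtained in this way is called a $D$-deep mixed-subtree quasi-isometry. *)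

theory Defs
  imports "HOL-Analysis.Abstract_Metric_Spaces"
begin

definition (in Metric_space) quasi_isometry :: "real \<Rightarrow> ('a \<Rightarrow> 'a) \<Rightarrow> bool" where
  "quasi_isometry C f \<longleftrightarrow>
     C \<ge> 1 \<and> f \<in> M \<rightarrow> M \<and>
     (\<forall>x\<in>M. \<forall>y\<in>M. d x y / C - C \<le> d (f x) (f y) \<and> d (f x) (f y) \<le> C * d x y + C) \<and>
     (\<exists>D'. \<forall>y\<in>M. \<exists>x\<in>M. d y (f x) \<le> D')"

locale simple_graph =
  fixes V :: "'a set" and E :: "'a \<Rightarrow> 'a \<Rightarrow> bool"
  assumes edge_verts: "E u v \<Longrightarrow> u \<in> V \<and> v \<in> V"
    and edge_sym: "E u v \<Longrightarrow> E v u"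
    and edge_irrefl: "\<not> E v v"
begin

text \<open>Walks are given by their nonempty lists of vertices, so a walk \<open>xs\<close> has
  \<open>length xs - 1\<close> edges.\<close>

definition walk :: "'a \<Rightarrow> 'a list \<Rightarrow> 'a \<Rightarrow> bool" where
  "walk u xs v \<longleftrightarrow>
     xs \<noteq> [] \<and> hd xs = u \<and> last xs = v \<and> set xs \<subseteq> V \<and> successively E xs"

definition simple_path :: "'a \<Rightarrow> 'a list \<Rightarrow> 'a \<Rightarrow> bool" where
  "simple_path u xs v \<longleftrightarrow> walk u xs v \<and> distinct xs"

definition path_dist :: "'a \<Rightarrow> 'a \<Rightarrow> nat" where
  "path_dist u v = (LEAST n. \<exists>xs. walk u xs v \<and> length xs = Suc n)"

lemma path_dist_le: "walk u xs v \<Longrightarrow> length xs = Suc n \<Longrightarrow> path_dist u v \<le> n"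
  unfolding path_dist_def by (rule Least_le) blast

lemma walk_rev: "walk u xs v \<Longrightarrow> walk v (rev xs) u"
  by (auto simp: walk_def hd_rev last_rev intro: successively_mono edge_sym)

lemma walk_append: "walk u xs v \<Longrightarrow> walk v ys w \<Longrightarrow> walk u (xs @ tl ys) w"
  by (cases ys) (auto simp: walk_def successively_append_iff successively_Cons split: if_splits)

lemma path_dist_commute: "path_dist u v = path_dist v u"
proof -
  have "(\<exists>xs. walk u xs v \<and> length xs = Suc n) \<longleftrightarrow> (\<exists>xs. walk v xs u \<and> length xs = Suc n)" for n
    using walk_rev by (metis length_rev)
  then show ?thesis by (simp add: path_dist_def)
qed

end

locale tree = simple_graph V E for V :: "'a set" and E :: "'a \<Rightarrow> 'a \<Rightarrow> bool" +
  assumes nonempty: "V \<noteq> {}"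
    and unique_path: "\<lbrakk>u \<in> V; v \<in> V\<rbrakk> \<Longrightarrow> \<exists>!xs. simple_path u xs v"
begin

definition geodesic :: "'a \<Rightarrow> 'a \<Rightarrow> 'a list" where
  "geodesic u v = (THE xs. simple_path u xs v)"

text \<open>In a tree every connected subgraph is induced, so a subtree is determined by its set of
  vertices.\<close>

definition subtree :: "'a set \<Rightarrow> bool" where
  "subtree S \<longleftrightarrow> S \<subseteq> V \<and> tree S (\<lambda>u v. u \<in> S \<and> v \<in> S \<and> E u v)"

lemma ex_shortest_walk:
  assumes "u \<in> V" "v \<in> V"
  shows "\<exists>xs. walk u xs v \<and> length xs = Suc (path_dist u v)"
proof -
  obtain xs where "walk u xs v"
    using unique_path[OF assms] by (auto simp: simple_path_def)
  then have "\<exists>ys. walk u ys v \<and> length ys = Suc (length xs - 1)"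
    by (intro exI[of _ xs]) (auto simp: walk_def)
  then show ?thesis
    unfolding path_dist_def by (rule LeastI)
qed

lemma Metric_space_path_dist: "Metric_space V (\<lambda>u v. real (path_dist u v))"
proof
  fix u v :: 'a
  show "0 \<le> real (path_dist u v)" by simp
  show "real (path_dist u v) = real (path_dist v u)" by (simp add: path_dist_commute)
next
  fix u v assume uv: "u \<in> V" "v \<in> V"
  show "real (path_dist u v) = 0 \<longleftrightarrow> u = v"
  proof
    assume "real (path_dist u v) = 0"
    then obtain xs where "walk u xs v" "length xs = Suc 0"
      using ex_shortest_walk[OF uv] by auto
    then show "u = v" by (cases xs) (auto simp: walk_def)
  next
    assume "u = v"
    then show "real (path_dist u v) = 0"
      using path_dist_le[of u "[u]" v 0] uv by (simp add: walk_def)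
  qed
next
  fix u v w assume "u \<in> V" "v \<in> V" "w \<in> V"
  then obtain xs ys where "walk u xs v" "length xs = Suc (path_dist u v)"
      "walk v ys w" "length ys = Suc (path_dist v w)"
    using ex_shortest_walk by meson
  then have "path_dist u w \<le> path_dist u v + path_dist v w"
    using path_dist_le[OF walk_append] by simp
  then show "real (path_dist u w) \<le> real (path_dist u v) + real (path_dist v w)" by linarith
qed

end

locale regular_tree = tree V E for V :: "'a set" and E :: "'a \<Rightarrow> 'a \<Rightarrow> bool" +
  fixes \<delta> :: nat
  assumes regular: "v \<in> V \<Longrightarrow> finite {u. E v u} \<and> card {u. E v u} = \<delta>"

locale rooted_tree = tree V E for V :: "'a set" and E :: "'a \<Rightarrow> 'a \<Rightarrow> bool" +
  fixes v\<^sub>0 :: 'a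
  assumes root_in: "v\<^sub>0 \<in> V"
begin

definition descendants :: "'a \<Rightarrow> 'a set" where
  "descendants w = {v \<in> V. w \<in> set (geodesic v\<^sub>0 v)}"

definition descendants_upto :: "nat \<Rightarrow> 'a \<Rightarrow> 'a set" where
  "descendants_upto k w = {v \<in> descendants w. path_dist w v \<le> k}"

definition nth_children :: "nat \<Rightarrow> 'a \<Rightarrow> 'a set" where
  "nth_children k w = {v \<in> descendants w. path_dist w v = k}"

definition parent :: "'a \<Rightarrow> 'a" where
  "parent v = (if v = v\<^sub>0 then v\<^sub>0 else (THE u. E v u \<and> u \<in> set (geodesic v\<^sub>0 v)))"

definition boundary :: "'a set \<Rightarrow> 'a set" where
  "boundary S = {v \<in> V - S. parent v \<in> S}"

definition order_preserving :: "('a \<Rightarrow> 'a) \<Rightarrow> bool" where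
  "order_preserving f \<longleftrightarrow>
     (\<forall>u\<in>V. \<forall>v\<in>V. v \<in> descendants u \<longrightarrow> f v \<in> descendants (f u))"

definition sphere :: "nat \<Rightarrow> 'a set" where
  "sphere n = {x \<in> V. path_dist v\<^sub>0 x = n}"

text \<open>\<open>level_fibre D i g v\<close> and \<open>level_children D i g v\<close> are the sets \<open>X\<close> and \<open>B\<^sub>v\<close> of the
  construction, when \<open>g\<close> is the map \<open>f\<^sub>i\<close>.\<close>

definition level_fibre :: "nat \<Rightarrow> nat \<Rightarrow> ('a \<Rightarrow> 'a) \<Rightarrow> 'a \<Rightarrow> 'a set" where
  "level_fibre D i g v = {x \<in> sphere (i * D). g x = v}"

definition level_children :: "nat \<Rightarrow> nat \<Rightarrow> ('a \<Rightarrow> 'a) \<Rightarrow> 'a \<Rightarrow> 'a set" where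
  "level_children D i g v = (\<Union>x\<in>level_fibre D i g v. nth_children D x)"

text \<open>The condition on the choice of a single function \<open>f'\<^sub>v\<close>.\<close>

definition admissible :: "nat \<Rightarrow> nat \<Rightarrow> ('a \<Rightarrow> 'a) \<Rightarrow> 'a \<Rightarrow> ('a \<Rightarrow> 'a) \<Rightarrow> bool" where
  "admissible D i g v f' \<longleftrightarrow>
     f' \<in> level_children D i g v \<rightarrow> descendants v \<and>
     (\<exists>S. finite S \<and> subtree S \<and> S \<subseteq> descendants v \<and> v \<in> S \<and>
          f' ` level_children D i g v = boundary S) \<and>
     (\<forall>w\<in>level_children D i g v. \<forall>w'\<in>level_children D i g v.
        f' w = f' w' \<longrightarrow>
        (\<exists>x\<in>level_fibre D i g v. w \<in> nth_children D x \<and> w' \<in> nth_children D x))"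

text \<open>\<open>h\<close> is obtained from \<open>g\<close> by one step, from \<open>f\<^sub>i\<close> to \<open>f\<^sub>i\<^sub>+\<^sub>1\<close>. Partial functions are represented
  by total ones, so only the values of \<open>g\<close> on the ball of radius \<open>i * D\<close> around the root, and those
  of \<open>h\<close> on the ball of radius \<open>(i + 1) * D\<close>, matter.\<close>

definition extension_step :: "nat \<Rightarrow> nat \<Rightarrow> ('a \<Rightarrow> 'a) \<Rightarrow> ('a \<Rightarrow> 'a) \<Rightarrow> bool" where
  "extension_step D i g h \<longleftrightarrow>
     (\<forall>x\<in>descendants_upto (i * D) v\<^sub>0. h x = g x) \<and>
     (\<forall>v\<in>g ` sphere (i * D). \<exists>f'. admissible D i g v f' \<and>
        (\<forall>w\<in>level_children D i g v. h w = f' w) \<and>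
        (\<forall>x\<in>level_fibre D i g v. \<forall>w\<in>descendants_upto (D - 1) x. h w = v))"

definition mixed_subtree_qi :: "nat \<Rightarrow> ('a \<Rightarrow> 'a) \<Rightarrow> bool" where
  "mixed_subtree_qi D f \<longleftrightarrow>
     (\<exists>F :: nat \<Rightarrow> 'a \<Rightarrow> 'a. F 0 v\<^sub>0 = v\<^sub>0 \<and>
        (\<forall>i. extension_step D i (F i) (F (Suc i))) \<and>
        (\<forall>i. \<forall>x\<in>descendants_upto (i * D) v\<^sub>0. f x = F i x))"

end

locale rooted_regular_tree = regular_tree V E \<delta> + rooted_tree V E v\<^sub>0
  for V :: "'a set" and E :: "'a \<Rightarrow> 'a \<Rightarrow> bool" and \<delta> :: nat and v\<^sub>0 :: 'a

end

theory Submission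
  imports Defs
begin

text \<open>Let \<open>f\<close> be a \<open>D\<close>-deep mixed-subtree quasi-isometry. By induction on \<open>i\<close>, the values of \<open>f\<close> on the
  sphere of radius \<open>i * D\<close> form an antichain, so two points of the next sphere with the same value
  lie in the same \<open>B\<^sub>v\<close> and hence, by the second condition on \<open>f'\<^sub>v\<close>, below the same point of
  this sphere. Thus the sets \<open>B\<^sub>v\<close> have at most \<open>K = \<delta>\<^sup>2\<^sup>D\<close> elements. As every
  vertex has at least two children, a finite subtree has at most as many vertices as its boundary,
  so all the \<open>S\<^sub>v\<close> have at most \<open>K\<close> vertices. Therefore \<open>f w\<close> is a descendant of \<open>f (parent w)\<close> at
  distance at most \<open>K\<close>, which gives order preservation and the upper bound; every vertex lies in
  some \<open>S\<^sub>v\<close>, within \<open>K\<close> of the image; and since each level strictly increases the depth of the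
  image, two branches of the tree keep moving apart after \<open>f\<close> is applied, at most two levels later
  than in the source.\<close>

section \<open>Walks and path distance\<close>

context simple_graph
begin

lemma walk_verts: "walk u xs v \<Longrightarrow> u \<in> V \<and> v \<in> V"
  by (auto simp: walk_def)

lemma walk_single: "v \<in> V \<Longrightarrow> walk v [v] v"
  by (simp add: walk_def)

lemma walk_Cons: "E u w \<Longrightarrow> walk w xs v \<Longrightarrow> walk u (u # xs) v"
  using edge_verts by (cases xs) (auto simp: walk_def)

lemma walk_snoc: "walk u xs v \<Longrightarrow> E v w \<Longrightarrow> walk u (xs @ [w]) w"
  using edge_verts by (auto simp: walk_def successively_append_iff)

lemma walk_induct [consumes 1, case_names single step]:
  assumes "walk u xs v"
    and "\<And>v. v \<in> V \<Longrightarrow> P v [v] v"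
    and "\<And>u w xs v. E u w \<Longrightarrow> walk w xs v \<Longrightarrow> P w xs v \<Longrightarrow> P u (u # xs) v"
  shows "P u xs v"
  using assms(1)
proof (induction xs arbitrary: u)
  case Nil
  then show ?case by (simp add: walk_def)
next
  case (Cons x xs)
  show ?case
  proof (cases xs)
    case Nil
    with Cons.prems show ?thesis by (auto simp: walk_def intro: assms(2))
  next
    case (Cons y ys)
    then have "E x y" "walk y xs v" "u = x"
      using Cons.prems by (auto simp: walk_def)
    then show ?thesis using Cons.IH assms(3) by blast
  qed
qed

lemma path_dist_le_length: "walk u xs v \<Longrightarrow> path_dist u v \<le> length xs - 1"
  by (rule path_dist_le) (auto simp: walk_def)

lemma path_dist_edge: "E u v \<Longrightarrow> path_dist u v \<le> 1"
  using path_dist_le_length[of u "[u, v]" v] edge_verts by (auto simp: walk_def)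

lemma walk_prefix: "walk u (xs @ x # ys) v \<Longrightarrow> walk u (xs @ [x]) x"
  by (auto simp: walk_def successively_append_iff hd_append)

end

context tree
begin

lemma path_dist_self [simp]: "v \<in> V \<Longrightarrow> path_dist v v = 0"
  using path_dist_le_length[OF walk_single] by simp

lemma path_dist_triangle:
  assumes "u \<in> V" "v \<in> V" "w \<in> V"
  shows "path_dist u w \<le> path_dist u v + path_dist v w"
  using Metric_space.triangle[OF Metric_space_path_dist assms] by linarith

lemma geodesic_eqI: "simple_path u xs v \<Longrightarrow> geodesic u v = xs"
  unfolding geodesic_def
  by (rule the1_equality[OF unique_path]) (auto simp: simple_path_def dest: walk_verts)

lemma simple_path_geodesic: "u \<in> V \<Longrightarrow> v \<in> V \<Longrightarrow> simple_path u (geodesic u v) v"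
  using unique_path geodesic_eqI by blast

lemma geodesic_self [simp]: "v \<in> V \<Longrightarrow> geodesic v v = [v]"
  by (rule geodesic_eqI) (simp add: simple_path_def walk_single)

end

section \<open>Geodesics from the root, parents and depth\<close>

context rooted_tree
begin

definition depth :: "'a \<Rightarrow> nat" where
  "depth v = path_dist v\<^sub>0 v"

lemma geodesic_prefix:
  assumes "v \<in> V" "geodesic v\<^sub>0 v = xs @ u # ys"
  shows "geodesic v\<^sub>0 u = xs @ [u]"
  using simple_path_geodesic[OF root_in assms(1)] assms(2) walk_prefix
  by (intro geodesic_eqI) (auto simp: simple_path_def)

lemma geodesic_snoc:
  assumes "E u v" "v \<notin> set (geodesic v\<^sub>0 u)"
  shows "geodesic v\<^sub>0 v = geodesic v\<^sub>0 u @ [v]"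
  using simple_path_geodesic[OF root_in, of u] edge_verts[OF assms(1)] assms walk_snoc
  by (intro geodesic_eqI) (auto simp: simple_path_def)

lemma last_geodesic: "v \<in> V \<Longrightarrow> geodesic v\<^sub>0 v \<noteq> [] \<and> last (geodesic v\<^sub>0 v) = v"
  using simple_path_geodesic[OF root_in] by (auto simp: simple_path_def walk_def)

lemma distinct_geodesic: "v \<in> V \<Longrightarrow> distinct (geodesic v\<^sub>0 v)"
  using simple_path_geodesic[OF root_in] by (auto simp: simple_path_def)

text \<open>If \<open>v\<close> lies on the geodesic to \<open>u\<close>, the prefix ending at
  \<open>v\<close> is the geodesic to \<open>v\<close>; it avoids \<open>u\<close>, so appending
  \<open>u\<close> gives a simple path. Otherwise appending \<open>v\<close> to the geodesic of
  \<open>u\<close> does. Hence every edge points away from the root in exactly one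
  direction.\<close>

lemma edge_geodesic:
  assumes "E u v"
  shows "geodesic v\<^sub>0 v = geodesic v\<^sub>0 u @ [v] \<or> geodesic v\<^sub>0 u = geodesic v\<^sub>0 v @ [u]"
proof (cases "v \<in> set (geodesic v\<^sub>0 u)")
  case True
  have V: "u \<in> V" "v \<in> V" and ne: "u \<noteq> v"
    using edge_verts[OF assms] assms edge_irrefl by auto
  obtain xs ys where eq: "geodesic v\<^sub>0 u = xs @ v # ys"
    using split_list[OF True] by blast
  then have gv: "geodesic v\<^sub>0 v = xs @ [v]"
    by (rule geodesic_prefix[OF V(1)])
  have "u \<in> set ys"
    using last_geodesic[OF V(1)] eq ne by (auto split: if_splits)
  then have "u \<notin> set (geodesic v\<^sub>0 v)"
    using distinct_geodesic[OF V(1)] eq gv ne by auto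
  then show ?thesis
    using geodesic_snoc[OF edge_sym[OF assms]] by blast
qed (simp add: geodesic_snoc[OF assms])

text \<open>A neighbour \<open>w\<close> of \<open>v\<close> on the geodesic to \<open>v\<close>
  cannot extend it, so by \<open>edge_geodesic\<close> the geodesic to \<open>w\<close> is that of
  \<open>v\<close> without its last vertex, which forces \<open>w = u\<close>.\<close>

lemma parent_eqI:
  assumes "E u v" "geodesic v\<^sub>0 v = geodesic v\<^sub>0 u @ [v]"
  shows "v \<noteq> v\<^sub>0 \<and> parent v = u"
proof -
  have V: "u \<in> V" "v \<in> V" using edge_verts[OF assms(1)] by auto
  have "v \<noteq> v\<^sub>0"
    using assms(2) last_geodesic[OF V(1)] root_in by auto
  moreover have "w = u" if w: "E v w" "w \<in> set (geodesic v\<^sub>0 v)" for w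
  proof -
    have "w \<noteq> v" using w edge_irrefl by blast
    have "geodesic v\<^sub>0 w \<noteq> geodesic v\<^sub>0 v @ [w]"
      using distinct_geodesic[of w] w edge_verts[OF w(1)] by auto
    then have "geodesic v\<^sub>0 v = geodesic v\<^sub>0 w @ [v]"
      using edge_geodesic[OF w(1)] by blast
    then show ?thesis
      using assms(2) last_geodesic V edge_verts[OF w(1)] by (metis butlast_snoc)
  qed
  moreover have "u \<in> set (geodesic v\<^sub>0 v)"
    using assms(2) last_geodesic[OF V(1)] by (metis last_in_set set_append Un_iff)
  ultimately have "(THE w. E v w \<and> w \<in> set (geodesic v\<^sub>0 v)) = u"
    using edge_sym[OF assms(1)] by (intro the_equality) blast+
  then show ?thesis using \<open>v \<noteq> v\<^sub>0\<close> by (simp add: parent_def)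
qed

lemma edge_parent: "E u v \<Longrightarrow> v \<noteq> v\<^sub>0 \<and> parent v = u \<or> u \<noteq> v\<^sub>0 \<and> parent u = v"
  using edge_geodesic[of u v] parent_eqI[of u v] parent_eqI[of v u] edge_sym[of u v] by metis

lemma
  assumes "v \<in> V" "v \<noteq> v\<^sub>0"
  shows parent_edge: "E (parent v) v"
    and geodesic_parent: "geodesic v\<^sub>0 v = geodesic v\<^sub>0 (parent v) @ [v]"
proof -
  obtain xs where xs: "geodesic v\<^sub>0 v = xs @ [v]"
    using last_geodesic[OF assms(1)] by (metis append_butlast_last_id)
  have w: "walk v\<^sub>0 (xs @ [v]) v"
    using simple_path_geodesic[OF root_in assms(1)] xs by (simp add: simple_path_def)
  then have "xs \<noteq> []" using assms(2) by (auto simp: walk_def)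
  then obtain ys u where ys: "xs = ys @ [u]" by (metis append_butlast_last_id)
  then have e: "E u v" using w by (auto simp: walk_def successively_append_iff)
  have g: "geodesic v\<^sub>0 u = xs" using geodesic_prefix[OF assms(1)] xs ys by simp
  then have "parent v = u" using parent_eqI[OF e] xs by simp
  then show "E (parent v) v" "geodesic v\<^sub>0 v = geodesic v\<^sub>0 (parent v) @ [v]"
    using e g xs by auto
qed

lemma parent_in: "v \<in> V \<Longrightarrow> parent v \<in> V"
  by (cases "v = v\<^sub>0") (use parent_edge[of v] edge_verts root_in in \<open>auto simp: parent_def\<close>)

lemma length_geodesic:
  assumes "v \<in> V"
  shows "length (geodesic v\<^sub>0 v) = Suc (depth v)"
proof -
  \<comment> \<open>Each edge changes the length of the geodesic by one, so no walk from the root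
    has fewer vertices than the geodesic to its endpoint.\<close>
  have *: "length (geodesic v\<^sub>0 y) < length (geodesic v\<^sub>0 x) + length xs" if "walk x xs y" for x xs y
    using that
  proof (induction rule: walk_induct)
    case (step u w xs v)
    then show ?case using edge_geodesic[OF step(1)] by (auto dest: arg_cong[where f = length])
  qed simp
  obtain xs where "walk v\<^sub>0 xs v" "length xs = Suc (depth v)"
    using ex_shortest_walk[OF root_in assms] by (auto simp: depth_def)
  then have "length (geodesic v\<^sub>0 v) \<le> Suc (depth v)"
    using *[of v\<^sub>0 xs v] root_in by simp
  moreover have "depth v \<le> length (geodesic v\<^sub>0 v) - 1"
    using path_dist_le_length simple_path_geodesic[OF root_in assms]
    by (auto simp: depth_def simple_path_def)
  ultimately show ?thesis using last_geodesic[OF assms] by (cases "geodesic v\<^sub>0 v") auto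
qed

lemma depth_root [simp]: "depth v\<^sub>0 = 0"
  using root_in by (simp add: depth_def)

lemma depth_parent: "v \<in> V \<Longrightarrow> v \<noteq> v\<^sub>0 \<Longrightarrow> depth v = Suc (depth (parent v))"
  using length_geodesic[of v] length_geodesic[OF parent_in, of v] geodesic_parent[of v] by simp

lemma depth_eq_0: "v \<in> V \<Longrightarrow> depth v = 0 \<longleftrightarrow> v = v\<^sub>0"
  using depth_parent by fastforce

lemma depth_induct [consumes 1, case_names root child]:
  assumes "v \<in> V" "P v\<^sub>0"
    and "\<And>v. v \<in> V \<Longrightarrow> v \<noteq> v\<^sub>0 \<Longrightarrow> P (parent v) \<Longrightarrow> P v"
  shows "P v"
  using assms(1)
proof (induction "depth v" arbitrary: v)
  case 0
  then show ?case using depth_eq_0 assms(2) by metis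
next
  case (Suc n)
  then show ?case using assms(3) depth_parent parent_in depth_root
    by (metis nat.inject nat.distinct(1))
qed

section \<open>The descendant order\<close>

lemma descendants_iff:
  assumes "v \<in> V" "v \<noteq> v\<^sub>0"
  shows "v \<in> descendants w \<longleftrightarrow> v = w \<or> parent v \<in> descendants w"
  using assms geodesic_parent[OF assms] parent_in[OF assms(1)] by (auto simp: descendants_def)

lemma root_descendant: "v\<^sub>0 \<in> descendants w \<longleftrightarrow> w = v\<^sub>0"
  using root_in by (auto simp: descendants_def)

lemma descendant_in: "v \<in> descendants w \<Longrightarrow> v \<in> V"
  by (simp add: descendants_def)

lemma ancestor_in: "v \<in> descendants w \<Longrightarrow> w \<in> V"
  using simple_path_geodesic[OF root_in, of v] by (auto simp: descendants_def simple_path_def walk_def)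

lemma descendants_refl: "v \<in> V \<Longrightarrow> v \<in> descendants v"
  using last_geodesic[of v] last_in_set[of "geodesic v\<^sub>0 v"] by (simp add: descendants_def)

lemma descendants_root: "v \<in> V \<Longrightarrow> v \<in> descendants v\<^sub>0"
  by (induction rule: depth_induct) (auto simp: descendants_iff descendants_refl root_in)

lemma descendants_trans:
  assumes "w \<in> descendants v" "v \<in> descendants u"
  shows "w \<in> descendants u"
  using descendant_in[OF assms(1)] assms
  by (induction rule: depth_induct) (auto simp: descendants_iff root_descendant)

lemma depth_descendant:
  assumes "w \<in> descendants v"
  shows "depth v < depth w \<or> v = w"
  using descendant_in[OF assms] assms
  by (induction rule: depth_induct) (auto simp: descendants_iff root_descendant depth_parent)

lemma depth_descendant_le: "w \<in> descendants v \<Longrightarrow> depth v \<le> depth w"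
  using depth_descendant by fastforce

lemma parent_descendant:
  assumes "v \<in> descendants w" "v \<noteq> w"
  shows "v \<noteq> v\<^sub>0" "parent v \<in> descendants w"
  using assms root_descendant[of w] descendants_iff[of v w] descendant_in[of v w] by auto

text \<open>The ancestors of \<open>v\<close> form a chain: climbing from \<open>v\<close> to the
  root, the deeper vertex \<open>b\<close> is met no later than \<open>a\<close>.\<close>

lemma descendants_comparable:
  assumes "v \<in> descendants a" "v \<in> descendants b" "depth a \<le> depth b"
  shows "b \<in> descendants a"
  using descendant_in[OF assms(1)] assms
proof (induction rule: depth_induct)
  case root
  then show ?case by (simp add: root_descendant)
next
  case (child v)
  then show ?case
    by (metis depth_descendant descendants_iff leD)
qed

section \<open>Distances in terms of depth\<close>

lemma path_dist_descendant:
  assumes "v \<in> descendants w"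
  shows "depth v = depth w + path_dist w v"
proof -
  have V: "v \<in> V" "w \<in> V" using assms descendant_in ancestor_in by auto
  have "depth w + path_dist w v \<le> depth v"
    using V(1) assms
  proof (induction rule: depth_induct)
    case root
    then show ?case by (simp add: root_descendant root_in)
  next
    case (child v)
    show ?case
    proof (cases "v = w")
      case False
      then have p: "parent v \<in> descendants w" using child by (simp add: descendants_iff)
      have "path_dist w v \<le> path_dist w (parent v) + path_dist (parent v) v"
        using path_dist_triangle child V parent_in by blast
      moreover have "path_dist (parent v) v \<le> 1"
        using path_dist_edge parent_edge child by blast
      ultimately show ?thesis using child p depth_parent[of v] by simp
    qed (use V in simp)
  qed
  moreover have "depth v \<le> depth w + path_dist w v"
    using path_dist_triangle[OF root_in] V by (simp add: depth_def)
  ultimately show ?thesis by simp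
qed

lemma depth_le_path_dist: "u \<in> V \<Longrightarrow> v \<in> V \<Longrightarrow> depth v \<le> depth u + path_dist u v"
  using path_dist_triangle[OF root_in] by (simp add: depth_def)

text \<open>Every edge joins a vertex to its parent, so the only exit from
  \<open>descendants a\<close> is the edge above \<open>a\<close>.\<close>

lemma edge_leaving_descendants:
  assumes "E u w" "u \<in> descendants a" "w \<notin> descendants a"
  shows "u = a \<and> w = parent a"
  using edge_parent[OF assms(1)] edge_verts[OF assms(1)] assms descendants_iff by metis

lemma parent_in_walk:
  assumes "walk u xs w" "u \<in> descendants a" "w \<notin> descendants a"
  shows "parent a \<in> set xs"
  using assms
proof (induction rule: walk_induct)
  case (step u w xs v)
  show ?case
  proof (cases "w \<in> descendants a")
    case False
    then have "w = parent a"
      using edge_leaving_descendants[OF step(1) step.prems(1)] by blast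
    then show ?thesis
      using step(2) by (metis hd_in_set list.set_intros(2) walk_def)
  qed (use step in auto)
qed simp

text \<open>A walk leaving \<open>descendants a\<close> must climb from \<open>u\<close> to
  \<open>a\<close> first, and each edge lowers the depth by at most one. Stated with sums of depths
  to avoid subtraction on naturals.\<close>

lemma path_dist_through:
  assumes "u \<in> descendants a" "w \<in> V" "w \<notin> descendants a"
  shows "depth u + path_dist a w \<le> depth a + path_dist u w"
proof -
  have "depth u + path_dist a v < depth a + length xs"
    if "walk u xs v" "u \<in> descendants a" "v \<notin> descendants a" for u xs v
    using that
  proof (induction rule: walk_induct)
    case (step u w xs v)
    show ?case
    proof (cases "w \<in> descendants a")
      case True
      have "depth u \<le> Suc (depth w)"
        using edge_parent[OF step(1)] depth_parent edge_verts[OF step(1)] by fastforce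
      then show ?thesis using step True by simp
    next
      case False
      then have "u = a" using edge_leaving_descendants[OF step(1) step.prems(1)] by blast
      then show ?thesis
        using path_dist_le_length[OF walk_Cons[OF step(1,2)]] step(2)
        by (cases xs) (auto simp: walk_def)
    qed
  qed simp
  then show ?thesis
    using ex_shortest_walk[OF descendant_in[OF assms(1)] assms(2)] assms by fastforce
qed

text \<open>A path from \<open>u\<close> to \<open>w\<close> has to climb up to \<open>a\<close> and
  descend again from \<open>b\<close>: \<open>path_dist_through\<close> is applied once at each end,
  and the distance from \<open>a\<close> to \<open>b\<close> is dropped.\<close>

lemma path_dist_incomparable:
  assumes "u \<in> descendants a" "w \<in> descendants b"
    and "a \<notin> descendants b" "b \<notin> descendants a"
  shows "depth u + depth w \<le> depth a + depth b + path_dist u w"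
proof -
  have V: "a \<in> V" "b \<in> V" "u \<in> V" "w \<in> V"
    using assms descendant_in ancestor_in by blast+
  have "w \<notin> descendants a"
    using descendants_comparable assms by (metis linear)
  then show ?thesis
    using path_dist_through[OF assms(1), of w] path_dist_through[OF assms(2), of a] V assms(3)
    by (simp add: path_dist_commute[of a])
qed

text \<open>The geodesic from the root meets each depth up to that of \<open>v\<close> exactly once,
  so list positions are depths. The value is meaningful only for
  \<open>n \<le> depth v\<close>.\<close>

definition ancestor :: "nat \<Rightarrow> 'a \<Rightarrow> 'a" where
  "ancestor n v = geodesic v\<^sub>0 v ! n"

lemma
  assumes "v \<in> V" "n \<le> depth v"
  shows ancestor_descendant: "v \<in> descendants (ancestor n v)"
    and depth_ancestor: "depth (ancestor n v) = n"
proof -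
  let ?g = "geodesic v\<^sub>0 v"
  have n: "n < length ?g" using length_geodesic assms by simp
  then show d: "v \<in> descendants (ancestor n v)"
    using assms by (simp add: descendants_def ancestor_def)
  have "geodesic v\<^sub>0 (?g ! n) = take n ?g @ [?g ! n]"
    using geodesic_prefix[OF assms(1)] id_take_nth_drop[OF n] by metis
  then show "depth (ancestor n v) = n"
    using length_geodesic[OF ancestor_in[OF d]] n by (simp add: ancestor_def)
qed

lemma descendants_antisym: "v \<in> descendants a \<Longrightarrow> v \<in> descendants b \<Longrightarrow> depth a = depth b \<Longrightarrow> a = b"
  using descendants_comparable[of v a b] depth_descendant[of b a] by auto

lemma ancestor_eqI: "v \<in> descendants a \<Longrightarrow> depth a = n \<Longrightarrow> ancestor n v = a"
  using descendants_antisym ancestor_descendant depth_ancestor depth_descendant_le descendant_in by metis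

lemma sphere_iff: "x \<in> sphere n \<longleftrightarrow> x \<in> V \<and> depth x = n"
  by (simp add: sphere_def depth_def)

lemma nth_children_iff: "v \<in> nth_children k w \<longleftrightarrow> v \<in> descendants w \<and> depth v = depth w + k"
  using path_dist_descendant by (auto simp: nth_children_def)

lemma descendants_upto_iff: "v \<in> descendants_upto k w \<longleftrightarrow> v \<in> descendants w \<and> depth v \<le> depth w + k"
  using path_dist_descendant by (auto simp: descendants_upto_def)

lemma descendants_upto_root: "v \<in> descendants_upto k v\<^sub>0 \<longleftrightarrow> v \<in> V \<and> depth v \<le> k"
  using descendants_root descendant_in by (auto simp: descendants_upto_iff)

definition children :: "'a \<Rightarrow> 'a set" where
  "children w = {c \<in> V. c \<noteq> v\<^sub>0 \<and> parent c = w}"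

lemma neighbours_eq:
  assumes "w \<in> V"
  shows "{u. E w u} = children w \<union> (if w = v\<^sub>0 then {} else {parent w})"
proof -
  have "E w (parent w)" if "w \<noteq> v\<^sub>0"
    using parent_edge[OF assms that] edge_sym by blast
  moreover have "E w u" if "u \<in> children w" for u
    using parent_edge[of u] that by (auto simp: children_def)
  moreover have "u \<in> children w \<or> w \<noteq> v\<^sub>0 \<and> u = parent w" if "E w u" for u
    using edge_parent[OF that] edge_verts[OF that] by (auto simp: children_def)
  ultimately show ?thesis by auto
qed

section \<open>Subtrees with top vertex \<open>v\<close> and their boundaries\<close>

context
  fixes S :: "'a set" and v :: 'a
  assumes subtree: "subtree S" and top: "v \<in> S" and below: "S \<subseteq> descendants v"
begin

text \<open>Connectedness gives a walk inside \<open>S\<close> from \<open>s\<close> up to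
  \<open>v\<close>. Since \<open>v\<close> is not below \<open>s\<close>, this walk passes through
  \<open>parent s\<close>.\<close>

lemma subtree_parent:
  assumes "s \<in> S" "s \<noteq> v"
  shows "parent s \<in> S"
proof -
  interpret S: tree S "\<lambda>u v. u \<in> S \<and> v \<in> S \<and> E u v"
    using subtree by (simp add: subtree_def)
  obtain xs where xs: "S.walk s xs v"
    using S.unique_path[OF assms(1) top] by (auto simp: S.simple_path_def)
  have SV: "S \<subseteq> V" using subtree by (simp add: subtree_def)
  have "walk s xs v"
    using xs SV by (auto simp: S.walk_def walk_def elim: successively_mono)
  moreover have "s \<in> descendants s"
    using assms SV by (auto intro: descendants_refl)
  moreover have "v \<notin> descendants s"
    using assms below depth_descendant[of v s] depth_descendant[of s v] by auto
  ultimately have "parent s \<in> set xs"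
    by (rule parent_in_walk)
  then show ?thesis
    using xs by (auto simp: S.walk_def)
qed

lemma subtree_between:
  assumes "s \<in> S" "s \<in> descendants a" "a \<in> descendants v"
  shows "a \<in> S"
  using descendant_in[OF assms(2)] assms
proof (induction rule: depth_induct)
  case root
  then show ?case by (simp add: root_descendant)
next
  case (child s)
  show ?case
  proof (cases "s = a")
    case False
    then have p: "parent s \<in> descendants a" using child by (simp add: descendants_iff)
    have "s \<noteq> v"
      using depth_descendant[OF p] depth_descendant[OF child(6)] depth_parent[OF child(1,2)] by auto
    then show ?thesis using child p subtree_parent by blast
  qed (use child in simp)
qed

lemma boundary_below:
  assumes "b \<in> boundary S"
  shows "b \<in> descendants v" "b \<noteq> v" "parent b \<in> S" "b \<noteq> v\<^sub>0" "depth v < depth b"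
proof -
  show p: "parent b \<in> S" and nv: "b \<noteq> v"
    using assms top by (auto simp: boundary_def)
  show nr: "b \<noteq> v\<^sub>0"
    using assms p by (auto simp: boundary_def parent_def)
  show d: "b \<in> descendants v"
    using p nr below assms descendants_iff[of b v] by (auto simp: boundary_def)
  show "depth v < depth b"
    using depth_descendant[OF d] nv by auto
qed

text \<open>A boundary vertex \<open>b'\<close> strictly above \<open>b\<close> would lie between
  \<open>v\<close> and \<open>parent b\<close>, both in \<open>S\<close>, and hence belong to
  \<open>S\<close>.\<close>

lemma boundary_antichain:
  assumes "b \<in> boundary S" "b' \<in> boundary S" "b \<in> descendants b'"
  shows "b = b'"
proof (rule ccontr)
  assume "b \<noteq> b'"
  then have "parent b \<in> descendants b'"
    using assms(3) parent_descendant by blast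
  then have "b' \<in> S"
    using subtree_between boundary_below assms(1,2) by blast
  then show False using assms(2) by (simp add: boundary_def)
qed

text \<open>\<open>S\<close> contains an ancestor of \<open>s\<close> at every depth from that of
  \<open>v\<close> to that of \<open>s\<close>, so it has at least that many elements.\<close>

lemma depth_subtree:
  assumes "finite S" "s \<in> S"
  shows "depth s < depth v + card S"
proof -
  have "n \<in> depth ` S" if n: "depth v \<le> n" "n \<le> depth s" for n
  proof -
    have s: "s \<in> V" "s \<in> descendants v" using assms below descendant_in by auto
    have "ancestor n s \<in> descendants v"
      using descendants_comparable[OF s(2) ancestor_descendant] depth_ancestor s n by simp
    then have "ancestor n s \<in> S"
      using subtree_between[OF assms(2) ancestor_descendant] s n by blast
    then show ?thesis using depth_ancestor[OF s(1) n(2)] by (metis imageI)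
  qed
  then have "{depth v..depth s} \<subseteq> depth ` S" by auto
  then have "card {depth v..depth s} \<le> card S"
    using assms(1) by (meson card_image_le card_mono finite_imageI le_trans)
  then show ?thesis
    using depth_descendant_le[of s v] assms(2) below by auto
qed

text \<open>On the way down from \<open>v\<close> to \<open>y\<close>, the first vertex outside
  \<open>S\<close> is a boundary vertex.\<close>

lemma subtree_or_below_boundary:
  assumes "y \<in> descendants v"
  shows "y \<in> S \<or> (\<exists>b\<in>boundary S. y \<in> descendants b)"
  using descendant_in[OF assms] assms
proof (induction rule: depth_induct)
  case root
  then show ?case using top by (simp add: root_descendant)
next
  case (child y)
  show ?case
  proof (cases "y = v")
    case False
    then have "parent y \<in> S \<or> (\<exists>b\<in>boundary S. parent y \<in> descendants b)"
      using child by (simp add: descendants_iff)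
    then show ?thesis
    proof
      assume "parent y \<in> S"
      then show ?thesis
        using child descendants_refl by (cases "y \<in> S") (auto simp: boundary_def)
    next
      assume "\<exists>b\<in>boundary S. parent y \<in> descendants b"
      then show ?thesis using child by (auto simp: descendants_iff)
    qed
  qed (use top in simp)
qed

end

end

section \<open>Counting in a regular tree\<close>

context rooted_regular_tree
begin

lemma
  assumes "w \<in> V"
  shows finite_children: "finite (children w)"
    and card_children_le: "card (children w) \<le> \<delta>"
    and card_children_ge: "\<delta> \<le> Suc (card (children w))"
proof -
  let ?P = "if w = v\<^sub>0 then {} else {parent w}"
  have eq: "{u. E w u} = children w \<union> ?P" by (rule neighbours_eq[OF assms])
  show fin: "finite (children w)"
    using regular[OF assms] unfolding eq by simp
  show "card (children w) \<le> \<delta>"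
    using regular[OF assms] unfolding eq by (metis card_mono sup_ge1)
  have "\<delta> \<le> card (children w) + card ?P"
    using regular[OF assms] unfolding eq by (metis card_Un_le)
  then show "\<delta> \<le> Suc (card (children w))" by (auto split: if_splits)
qed

lemma card_nth_children:
  assumes "w \<in> V"
  shows "finite (nth_children n w) \<and> card (nth_children n w) \<le> \<delta> ^ n"
proof (induction n)
  case 0
  have "nth_children 0 w = {w}"
    using descendants_refl[OF assms] depth_descendant by (fastforce simp: nth_children_iff)
  then show ?case by simp
next
  case (Suc n)
  let ?U = "\<Union>u\<in>nth_children n w. children u"
  have V: "nth_children n w \<subseteq> V" by (auto simp: nth_children_iff dest: descendant_in)
  have sub: "nth_children (Suc n) w \<subseteq> ?U"
  proof
    fix c assume c: "c \<in> nth_children (Suc n) w"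
    then have "c \<noteq> w" "c \<in> V" by (auto simp: nth_children_iff dest: descendant_in)
    then show "c \<in> ?U"
      using c parent_descendant[of c w] depth_parent[of c] by (auto simp: nth_children_iff children_def)
  qed
  have fin: "finite ?U" using Suc V finite_children by blast
  have "card ?U \<le> (\<Sum>u\<in>nth_children n w. card (children u))"
    using Suc by (intro card_UN_le) auto
  also have "\<dots> \<le> (\<Sum>u\<in>nth_children n w. \<delta>)"
    using V card_children_le by (intro sum_mono) auto
  also have "\<dots> \<le> \<delta> ^ Suc n" using Suc by simp
  finally show ?case
    using card_mono[OF fin sub] finite_subset[OF sub fin] by simp
qed

text \<open>The vertices of \<open>S\<close> have disjoint sets of at least two children each, and
  every such child lies in \<open>S - {v}\<close> or in the boundary. So twice \<open>card S\<close>
  is at most \<open>card S - 1\<close> plus the size of the boundary.\<close>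

lemma card_subtree_le_boundary:
  assumes "\<delta> \<ge> 3" "finite S" "subtree S" "v \<in> S" "S \<subseteq> descendants v"
  shows "card S \<le> card (boundary S)"
proof -
  have V: "S \<subseteq> V" using assms(5) descendant_in by blast
  let ?U = "\<Union>s\<in>S. children s"
  have fin: "finite ?U" using assms(2) V finite_children by blast
  have finb: "finite (boundary S)"
    by (rule finite_subset[OF _ fin])
      (use boundary_below(4)[OF assms(3-5)] in \<open>auto simp: boundary_def children_def\<close>)
  have "?U \<subseteq> (S - {v}) \<union> boundary S"
  proof
    fix c assume "c \<in> ?U"
    then have c: "c \<in> V" "c \<noteq> v\<^sub>0" "parent c \<in> S" by (auto simp: children_def)
    then have "c \<noteq> v"
      using assms(5) depth_parent[of c] depth_descendant_le[of "parent c" v] by auto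
    then show "c \<in> (S - {v}) \<union> boundary S" using c by (auto simp: boundary_def)
  qed
  then have "card ?U \<le> card (S - {v}) + card (boundary S)"
    using assms(2) finb by (meson card_mono card_Un_le finite_Diff finite_UnI le_trans)
  moreover have "card ?U = (\<Sum>s\<in>S. card (children s))"
    using assms(2) V finite_children by (intro card_UN_disjoint) (auto simp: children_def)
  moreover have "(\<Sum>s\<in>S. 2) \<le> (\<Sum>s\<in>S. card (children s))"
    using V card_children_ge assms(1) by (intro sum_mono) fastforce
  ultimately show ?thesis using assms(2,4) by simp
qed

end

locale deep_map = rooted_regular_tree V E \<delta> v\<^sub>0
  for V :: "'a set" and E :: "'a \<Rightarrow> 'a \<Rightarrow> bool" and \<delta> :: nat and v\<^sub>0 :: 'a +
  fixes D :: nat and f :: "'a \<Rightarrow> 'a"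
  assumes degree: "\<delta> \<ge> 3" and D_pos: "D \<ge> 1"
    and f_root: "f v\<^sub>0 = v\<^sub>0"
    and step: "extension_step D i f f"

text \<open>The step from \<open>F i\<close> to \<open>F (Suc i)\<close> reads these maps only on
  balls where they agree with \<open>f\<close>. The sequence can therefore be replaced by the single
  map \<open>f\<close>, which satisfies the step condition at every level.\<close>

lemma (in rooted_regular_tree) deep_map_mixed_subtree_qi:
  assumes "\<delta> \<ge> 3" "D \<ge> 1" "mixed_subtree_qi D f"
  shows "deep_map V E \<delta> v\<^sub>0 D f"
proof
  obtain F where F: "F 0 v\<^sub>0 = v\<^sub>0" "\<And>i. extension_step D i (F i) (F (Suc i))"
      and f: "\<And>i x. x \<in> descendants_upto (i * D) v\<^sub>0 \<Longrightarrow> f x = F i x"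
    using assms(3) by (auto simp: mixed_subtree_qi_def)
  have f': "f x = F i x" if "x \<in> V" "depth x \<le> i * D" for i x
    using f that by (simp add: descendants_upto_root)
  show "f v\<^sub>0 = v\<^sub>0" using f'[of v\<^sub>0 0] F(1) root_in by simp
  fix i
  have fib: "level_fibre D i (F i) v = level_fibre D i f v" for v
    using f'[of _ i] by (auto simp: level_fibre_def sphere_iff)
  then have ch: "level_children D i (F i) v = level_children D i f v" for v
    by (simp add: level_children_def)
  have adm: "admissible D i (F i) v f' = admissible D i f v f'" for v f'
    by (simp add: admissible_def fib ch)
  have im: "F i ` sphere (i * D) = f ` sphere (i * D)"
    using f'[of _ i] by (intro image_cong) (auto simp: sphere_iff)
  have lc: "f w = F (Suc i) w" if "w \<in> level_children D i f v" for v w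
    using that by (intro f')
      (auto simp: level_children_def nth_children_iff level_fibre_def sphere_iff dest: descendant_in)
  have lu: "f w = F (Suc i) w" if "x \<in> level_fibre D i f v" "w \<in> descendants_upto (D - 1) x" for v x w
    using that by (intro f')
      (auto simp: descendants_upto_iff level_fibre_def sphere_iff dest: descendant_in)
  show "extension_step D i f f"
    using F(2)[of i] unfolding extension_step_def fib ch adm im
    by (metis lc lu)
qed (use assms in auto)

section \<open>Levels, that is, spheres of radius \<open>i * D\<close>, and their images\<close>

context deep_map
begin

definition level_anc :: "nat \<Rightarrow> 'a \<Rightarrow> 'a" where
  "level_anc i x = ancestor (i * D) x"

lemma level_anc:
  assumes "x \<in> V" "i * D \<le> depth x"
  shows "level_anc i x \<in> V" "depth (level_anc i x) = i * D" "x \<in> descendants (level_anc i x)"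
  using ancestor_descendant[OF assms] depth_ancestor[OF assms] ancestor_in
  by (auto simp: level_anc_def)

lemma level_anc_eqI: "x \<in> descendants a \<Longrightarrow> depth a = i * D \<Longrightarrow> level_anc i x = a"
  by (simp add: level_anc_def ancestor_eqI)

lemma level_anc_self: "x \<in> V \<Longrightarrow> depth x = i * D \<Longrightarrow> level_anc i x = x"
  by (rule level_anc_eqI[OF descendants_refl])

lemma level_anc_level_anc:
  assumes "x \<in> V" "j * D \<le> depth x" "i \<le> j"
  shows "level_anc i (level_anc j x) = level_anc i x"
proof -
  have "i * D \<le> depth (level_anc j x)" using level_anc[OF assms(1,2)] assms(3) by simp
  then show ?thesis
    using level_anc[OF assms(1,2)] level_anc[of "level_anc j x" i]
    by (metis level_anc_eqI descendants_trans)
qed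

lemma level_fibre_iff: "x \<in> level_fibre D i f v \<longleftrightarrow> x \<in> V \<and> depth x = i * D \<and> f x = v"
  by (simp add: level_fibre_def sphere_iff)

lemma level_children_iff:
  "w \<in> level_children D i f v \<longleftrightarrow> w \<in> V \<and> depth w = Suc i * D \<and> f (level_anc i w) = v"
proof
  assume "w \<in> level_children D i f v"
  then obtain x where x: "x \<in> V" "depth x = i * D" "f x = v" "w \<in> descendants x" "depth w = depth x + D"
    by (auto simp: level_children_def level_fibre_iff nth_children_iff)
  then show "w \<in> V \<and> depth w = Suc i * D \<and> f (level_anc i w) = v"
    using level_anc_eqI[OF x(4,2)] descendant_in by auto
next
  assume w: "w \<in> V \<and> depth w = Suc i * D \<and> f (level_anc i w) = v"
  then show "w \<in> level_children D i f v"
    using level_anc[of w i] by (auto simp: level_children_def level_fibre_iff nth_children_iff)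
qed

lemma f_between_levels:
  assumes "x \<in> V" "depth x = i * D" "w \<in> descendants x" "depth w < Suc i * D"
  shows "f w = f x"
proof -
  have "x \<in> sphere (i * D)" "x \<in> level_fibre D i f (f x)"
    using assms by (auto simp: sphere_iff level_fibre_iff)
  \<comment> \<open>As \<open>D \<ge> 1\<close>, depth below that of the next level means distance
    at most \<open>D - 1\<close> from \<open>x\<close>, without truncation in the
    subtraction.\<close>
  moreover have "w \<in> descendants_upto (D - 1) x"
    using assms D_pos by (auto simp: descendants_upto_iff)
  ultimately show ?thesis using step[of i] unfolding extension_step_def by blast
qed

text \<open>Reduces all questions about \<open>f\<close> to level vertices, because \<open>f\<close>
  is constant from a level vertex down to just before the next level.\<close>

lemma f_level_anc:
  assumes "x \<in> V"
  shows "f x = f (level_anc (depth x div D) x)"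
proof -
  have "depth x div D * D \<le> depth x" by simp
  then show ?thesis
    using level_anc[OF assms] D_pos dividend_less_div_times[of D "depth x"]
    by (intro f_between_levels) (auto simp: add.commute)
qed

text \<open>Restates \<open>admissible\<close> for \<open>f\<close> itself, which agrees with the
  chosen function on \<open>B\<^sub>v\<close>. A vertex of level \<open>i + 1\<close> has only one
  ancestor on level \<open>i\<close>, so condition (2) becomes an equation between
  ancestors.\<close>

lemma level_boundary:
  assumes "x \<in> V" "depth x = i * D"
  obtains S where "finite S" "subtree S" "S \<subseteq> descendants (f x)" "f x \<in> S"
    "f ` level_children D i f (f x) = boundary S"
    "\<And>w w'. w \<in> level_children D i f (f x) \<Longrightarrow> w' \<in> level_children D i f (f x) \<Longrightarrow> f w = f w' \<Longrightarrow>
       level_anc i w = level_anc i w'"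
proof -
  have "x \<in> sphere (i * D)" using assms by (simp add: sphere_iff)
  then obtain f' where f': "admissible D i f (f x) f'"
      and eq: "\<And>w. w \<in> level_children D i f (f x) \<Longrightarrow> f w = f' w"
    using step[of i] unfolding extension_step_def by blast
  have "f ` level_children D i f (f x) = f' ` level_children D i f (f x)"
    using eq by (rule image_cong[OF refl])
  moreover have "level_anc i w = level_anc i w'"
    if w: "w \<in> level_children D i f (f x)" "w' \<in> level_children D i f (f x)" "f w = f w'" for w w'
  proof -
    obtain y where "y \<in> level_fibre D i f (f x)" "w \<in> nth_children D y" "w' \<in> nth_children D y"
      using f' eq w unfolding admissible_def by metis
    then show ?thesis
      using level_anc_eqI[of w y i] level_anc_eqI[of w' y i]
      by (simp add: level_fibre_iff nth_children_iff)
  qed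
  ultimately show ?thesis
    using that f' unfolding admissible_def by metis
qed

lemma f_level_descendant:
  assumes "w \<in> V" "depth w = Suc i * D"
  shows "f w \<in> descendants (f (level_anc i w)) \<and> depth (f (level_anc i w)) < depth (f w)"
proof -
  have x: "level_anc i w \<in> V" "depth (level_anc i w) = i * D"
    using level_anc[of w i] assms by auto
  obtain S where S: "subtree S" "f (level_anc i w) \<in> S" "S \<subseteq> descendants (f (level_anc i w))"
      "f ` level_children D i f (f (level_anc i w)) = boundary S"
    using level_boundary[OF x] by metis
  have "f w \<in> boundary S"
    using assms by (auto simp: level_children_iff simp flip: S(4))
  then show ?thesis using boundary_below[OF S(1-3)] by blast
qed

text \<open>The images of the two ancestors one level up are both ancestors of \<open>f x\<close>,
  hence comparable, hence equal by induction. Then \<open>f x\<close> and \<open>f y\<close> lie in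
  the boundary of one subtree, which is an antichain.\<close>

lemma level_images_antichain:
  assumes "x \<in> V" "y \<in> V" "depth x = i * D" "depth y = i * D" "f x \<in> descendants (f y)"
  shows "f x = f y"
  using assms
proof (induction i arbitrary: x y)
  case 0
  then show ?case by (simp add: depth_eq_0)
next
  case (Suc i)
  let ?x = "level_anc i x" and ?y = "level_anc i y"
  have x: "?x \<in> V" "depth ?x = i * D" and y: "?y \<in> V" "depth ?y = i * D"
    using level_anc[of x i] level_anc[of y i] Suc.prems by auto
  have "f x \<in> descendants (f ?x)" "f x \<in> descendants (f ?y)"
    using f_level_descendant Suc.prems descendants_trans by blast+
  then have "f ?x \<in> descendants (f ?y) \<or> f ?y \<in> descendants (f ?x)"
    using descendants_comparable by (meson linear)
  then have eq: "f ?y = f ?x"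
    using Suc.IH x y by metis
  obtain S where S: "subtree S" "f ?x \<in> S" "S \<subseteq> descendants (f ?x)"
      "f ` level_children D i f (f ?x) = boundary S"
    using level_boundary[OF x] by metis
  have "f x \<in> boundary S" "f y \<in> boundary S"
    using Suc.prems eq by (auto simp: level_children_iff simp flip: S(4))
  then show ?case using boundary_antichain[OF S(1-3)] Suc.prems by blast
qed

text \<open>The antichain property puts \<open>x\<close> and \<open>y\<close> into the same
  \<open>B\<^sub>v\<close>, where condition (2) applies.\<close>

lemma level_fibre_same_anc:
  assumes "x \<in> V" "y \<in> V" "depth x = Suc i * D" "depth y = Suc i * D" "f x = f y"
  shows "level_anc i x = level_anc i y"
proof -
  let ?x = "level_anc i x" and ?y = "level_anc i y"
  have x: "?x \<in> V" "depth ?x = i * D" and y: "?y \<in> V" "depth ?y = i * D"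
    using level_anc[of x i] level_anc[of y i] assms by auto
  have "f x \<in> descendants (f ?x)" "f x \<in> descendants (f ?y)"
    using f_level_descendant assms by metis+
  then have "f ?x \<in> descendants (f ?y) \<or> f ?y \<in> descendants (f ?x)"
    using descendants_comparable by (meson linear)
  then have "f ?y = f ?x"
    using level_images_antichain x y by metis
  then show ?thesis
    using level_boundary[OF x] assms by (metis level_children_iff)
qed

section \<open>Uniform bounds on fibres and subtrees\<close>

lemma card_level_fibre: "finite (level_fibre D i f v) \<and> card (level_fibre D i f v) \<le> \<delta> ^ D"
proof (cases i)
  case 0
  then have "level_fibre D i f v \<subseteq> {v\<^sub>0}"
    using depth_eq_0 by (auto simp: level_fibre_iff)
  then have "finite (level_fibre D i f v) \<and> card (level_fibre D i f v) \<le> card {v\<^sub>0}"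
    by (meson card_mono finite.emptyI finite.insertI finite_subset)
  moreover have "1 \<le> \<delta> ^ D" using degree by (intro one_le_power) simp
  ultimately show ?thesis by simp
next
  case (Suc j)
  show ?thesis
  proof (cases "level_fibre D i f v = {}")
    case False
    then obtain x where "x \<in> level_fibre D i f v" by blast
    then have x: "x \<in> V" "depth x = Suc j * D" "f x = v"
      using Suc by (auto simp: level_fibre_iff)
    let ?a = "level_anc j x"
    have a: "?a \<in> V" "depth ?a = j * D" using level_anc[of x j] x by auto
    have "level_fibre D i f v \<subseteq> nth_children D ?a"
    proof
      fix y assume "y \<in> level_fibre D i f v"
      then have y: "y \<in> V" "depth y = Suc j * D" "f y = v"
        using Suc by (auto simp: level_fibre_iff)
      then have "level_anc j y = ?a"
        using level_fibre_same_anc x by metis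
      then show "y \<in> nth_children D ?a"
        using level_anc[of y j] y by (auto simp: nth_children_iff)
    qed
    then show ?thesis
      using card_nth_children[OF a(1)] by (meson card_mono finite_subset le_trans)
  qed simp
qed

text \<open>A fibre has at most \<open>\<delta> ^ D\<close> vertices, each with at most
  \<open>\<delta> ^ D\<close> \<open>D\<close>-children. The value does not depend on
  \<open>f\<close>, which makes the final constant uniform.\<close>

definition K :: nat where
  "K = \<delta> ^ D * \<delta> ^ D"

lemma card_level_children: "finite (level_children D i f v) \<and> card (level_children D i f v) \<le> K"
proof -
  have fin: "finite (level_fibre D i f v)" and V: "level_fibre D i f v \<subseteq> V"
    using card_level_fibre by (auto simp: level_fibre_iff)
  have "card (level_children D i f v) \<le> (\<Sum>x\<in>level_fibre D i f v. card (nth_children D x))"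
    unfolding level_children_def using fin by (rule card_UN_le)
  also have "\<dots> \<le> (\<Sum>x\<in>level_fibre D i f v. \<delta> ^ D)"
    using V card_nth_children by (intro sum_mono) auto
  also have "\<dots> \<le> K"
    using card_level_fibre by (simp add: K_def)
  finally show ?thesis
    using fin V card_nth_children by (auto simp: level_children_def)
qed

text \<open>The boundary is the image of \<open>B\<^sub>v\<close>, so \<open>S\<close> is no larger
  than its boundary and the boundary no larger than \<open>K\<close>.\<close>

lemma level_subtree:
  assumes "x \<in> V" "depth x = i * D"
  obtains S where "finite S" "subtree S" "f x \<in> S" "S \<subseteq> descendants (f x)"
    "f ` level_children D i f (f x) = boundary S" "card S \<le> K"
proof -
  obtain S where S: "finite S" "subtree S" "f x \<in> S" "S \<subseteq> descendants (f x)"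
      "f ` level_children D i f (f x) = boundary S"
    using level_boundary[OF assms] by metis
  have "card S \<le> card (boundary S)"
    by (rule card_subtree_le_boundary[OF degree S(1-4)])
  also have "\<dots> \<le> K"
    using card_level_children card_image_le unfolding S(5)[symmetric] by (meson le_trans)
  finally show ?thesis using that S by blast
qed

lemma depth_f_level_le:
  assumes "w \<in> V" "depth w = Suc i * D"
  shows "depth (f w) \<le> depth (f (level_anc i w)) + K"
proof -
  let ?x = "level_anc i w"
  have x: "?x \<in> V" "depth ?x = i * D"
    using level_anc[of w i] assms by auto
  obtain S where S: "finite S" "subtree S" "f ?x \<in> S" "S \<subseteq> descendants (f ?x)"
      "f ` level_children D i f (f ?x) = boundary S" "card S \<le> K"
    using level_subtree[OF x] by metis
  have "f w \<in> boundary S"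
    using assms by (auto simp: level_children_iff simp flip: S(5))
  then have "parent (f w) \<in> S" "f w \<in> V" "f w \<noteq> v\<^sub>0"
    using boundary_below[OF S(2-4)] descendant_in by blast+
  then show ?thesis
    using depth_subtree[OF S(2-4,1)] depth_parent[of "f w"] S(6) by fastforce
qed

text \<open>Sums the one-level estimates over \<open>m\<close> levels. The lower bound
  \<open>m\<close> drives images apart; the upper bound controls a branch that has only few
  levels.\<close>

lemma f_iterated_level:
  assumes "w \<in> V" "depth w = (i + m) * D"
  shows "f w \<in> descendants (f (level_anc i w)) \<and>
    depth (f (level_anc i w)) + m \<le> depth (f w) \<and> depth (f w) \<le> depth (f (level_anc i w)) + m * K"
  using assms
proof (induction m arbitrary: w)
  case 0
  \<comment> \<open>For \<open>m = 0\<close> the claim is reflexivity of \<open>descendants\<close>,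
    which requires \<open>f w\<close> in \<open>V\<close>; this comes from the step leading to level
    \<open>i\<close>, or from \<open>f_root\<close> at level 0.\<close>
  have "f w \<in> V"
  proof (cases i)
    case 0
    then show ?thesis using \<open>depth w = _\<close> depth_eq_0 f_root root_in "0.prems" by simp
  next
    case (Suc j)
    then show ?thesis using f_level_descendant[of w j] "0.prems" descendant_in by auto
  qed
  then show ?case using "0.prems" level_anc_self descendants_refl by simp
next
  case (Suc m)
  let ?u = "level_anc (i + m) w"
  have le: "(i + m) * D \<le> depth w" and w: "depth w = Suc (i + m) * D" using Suc.prems by auto
  have u: "?u \<in> V" "depth ?u = (i + m) * D" using level_anc[OF Suc.prems(1) le] by auto
  have eq: "level_anc i ?u = level_anc i w"
    by (rule level_anc_level_anc[OF Suc.prems(1) le]) simp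
  note IH = Suc.IH[OF u, unfolded eq]
  show ?case
    using IH f_level_descendant[OF Suc.prems(1) w] depth_f_level_le[OF Suc.prems(1) w] descendants_trans
    by auto
qed

lemma f_in:
  assumes "x \<in> V"
  shows "f x \<in> V"
proof -
  let ?i = "depth x div D"
  have "level_anc ?i x \<in> V" "depth (level_anc ?i x) = (0 + ?i) * D"
    using level_anc[OF assms, of ?i] by auto
  then have "f (level_anc ?i x) \<in> V"
    using f_iterated_level descendant_in by blast
  then show ?thesis using f_level_anc[OF assms] by simp
qed

text \<open>Either \<open>w\<close> shares the block of its parent and \<open>f\<close> does not
  change, or \<open>w\<close> is the first vertex on the next level and the one-level bounds
  apply.\<close>

lemma f_parent:
  assumes "w \<in> V" "w \<noteq> v\<^sub>0"
  shows "f w \<in> descendants (f (parent w)) \<and> depth (f w) \<le> depth (f (parent w)) + K"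
proof -
  let ?i = "depth (parent w) div D"
  let ?x = "level_anc ?i (parent w)"
  have p: "parent w \<in> V" "depth w = Suc (depth (parent w))"
    using assms parent_in depth_parent by auto
  have x: "?x \<in> V" "depth ?x = ?i * D" "parent w \<in> descendants ?x"
    using level_anc[OF p(1), of ?i] by auto
  have wx: "w \<in> descendants ?x" using x(3) descendants_iff[OF assms] by blast
  have fp: "f (parent w) = f ?x" using f_level_anc[OF p(1)] .
  have "depth (parent w) < Suc ?i * D"
    using D_pos dividend_less_div_times[of D "depth (parent w)"] by simp
  then consider "depth w < Suc ?i * D" | "depth w = Suc ?i * D" using p(2) by linarith
  then show ?thesis
  proof cases
    case 1
    then have "f w = f ?x" using f_between_levels[OF x(1,2) wx] by blast
    then show ?thesis using fp f_in[OF x(1)] descendants_refl by simp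
  next
    case 2
    have "level_anc ?i w = ?x" using level_anc_eqI[OF wx x(2)] .
    then show ?thesis
      using f_level_descendant[OF assms(1) 2] depth_f_level_le[OF assms(1) 2] fp by simp
  qed
qed

lemma order_preserving_f: "order_preserving f"
proof -
  have "f v \<in> descendants (f u)" if "u \<in> V" "v \<in> V" "v \<in> descendants u" for u v
    using that(2,3)
  proof (induction rule: depth_induct)
    case root
    then show ?case using f_in[OF root_in] descendants_refl by (simp add: root_descendant)
  next
    case (child v)
    show ?case
    proof (cases "v = u")
      case True
      then show ?thesis using f_in[OF that(1)] descendants_refl by simp
    next
      case False
      then show ?thesis
        using child f_parent descendants_iff descendants_trans by blast
    qed
  qed
  then show ?thesis by (simp add: order_preserving_def)
qed

section \<open>The quasi-isometry estimates\<close>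

lemma f_edge:
  assumes "E u v"
  shows "path_dist (f u) (f v) \<le> K"
proof -
  have *: "path_dist (f (parent w)) (f w) \<le> K" if "w \<in> V" "w \<noteq> v\<^sub>0" for w
    using f_parent[OF that] path_dist_descendant by fastforce
  show ?thesis
    using edge_parent[OF assms] edge_verts[OF assms] * path_dist_commute by metis
qed

lemma f_lipschitz:
  assumes "u \<in> V" "v \<in> V"
  shows "path_dist (f u) (f v) \<le> K * path_dist u v"
proof -
  have "path_dist (f u) (f v) \<le> K * (length xs - 1)" if "walk u xs v" for u xs v
    using that
  proof (induction rule: walk_induct)
    case (single v)
    then show ?case using f_in by simp
  next
    case (step u w xs v)
    have V: "u \<in> V" "w \<in> V" "v \<in> V" using edge_verts[OF step(1)] walk_verts[OF step(2)] by auto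
    have "path_dist (f u) (f v) \<le> path_dist (f u) (f w) + path_dist (f w) (f v)"
      using path_dist_triangle V f_in by blast
    also have "\<dots> \<le> K + K * (length xs - 1)"
      using f_edge[OF step(1)] step(3) by simp
    also have "\<dots> = K * (length (u # xs) - 1)"
      using step(2) by (cases xs) (auto simp: walk_def)
    finally show ?case .
  qed
  then show ?thesis using ex_shortest_walk[OF assms] by fastforce
qed

lemma f_coarsely_surjective:
  assumes "y \<in> V"
  shows "\<exists>x\<in>V. path_dist y (f x) \<le> K"
proof (rule ccontr)
  assume far: "\<not> ?thesis"
  \<comment> \<open>Every vertex of \<open>S\<close> is within \<open>K\<close> of
    \<open>f x\<close>, so a vertex \<open>y\<close> far from the image lies outside
    \<open>S\<close> and thus below a boundary vertex, which is the image of a vertex one level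
    further down.\<close>
  have "\<exists>x\<in>V. depth x = i * D \<and> y \<in> descendants (f x)" for i
  proof (induction i)
    case 0
    then show ?case using descendants_root[OF assms] root_in f_root by (intro bexI[of _ v\<^sub>0]) auto
  next
    case (Suc i)
    then obtain x where x: "x \<in> V" "depth x = i * D" "y \<in> descendants (f x)" by blast
    obtain S where S: "finite S" "subtree S" "f x \<in> S" "S \<subseteq> descendants (f x)"
        "f ` level_children D i f (f x) = boundary S" "card S \<le> K"
      using level_subtree[OF x(1,2)] by metis
    have "y \<notin> S"
    proof
      assume "y \<in> S"
      then have "path_dist (f x) y \<le> K"
        using depth_subtree[OF S(2-4,1)] path_dist_descendant[OF x(3)] S(6) by fastforce
      then show False using far x(1) by (auto simp: path_dist_commute)
    qed
    then obtain b where "b \<in> boundary S" "y \<in> descendants b"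
      using subtree_or_below_boundary[OF S(2-4) x(3)] by blast
    then obtain w where "w \<in> level_children D i f (f x)" "y \<in> descendants (f w)"
      unfolding S(5)[symmetric] by blast
    then show ?case by (auto simp: level_children_iff)
  qed
  \<comment> \<open>Images on level \<open>Suc (depth y)\<close> are deeper than \<open>y\<close>,
    so none of them can be an ancestor of \<open>y\<close>.\<close>
  then obtain x where x: "x \<in> V" "depth x = (0 + Suc (depth y)) * D" "y \<in> descendants (f x)"
    by (metis add_0)
  have "Suc (depth y) \<le> depth (f x)"
    using f_iterated_level[OF x(1,2)] by linarith
  then show False using depth_descendant_le[OF x(3)] by simp
qed

text \<open>If \<open>a\<close> is the last level at which \<open>x\<close> and \<open>y\<close> have the same ancestor, then the images of
  their ancestors at level \<open>a + 1\<close> may still coincide, but those at level \<open>a + 2\<close> cannot, and by the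
  antichain property the subtrees below the latter are disjoint.\<close>

lemma f_lower_bound:
  assumes "x \<in> V" "y \<in> V"
  shows "path_dist x y \<le> D * (path_dist (f x) (f y) + K + 6)"
proof -
  define i j where "i = depth x div D" and "j = depth y div D"
  \<comment> \<open>The common levels of \<open>x\<close> and \<open>y\<close>: 0 is one because of
    the root, and they are bounded by \<open>i\<close>, so a greatest one exists.\<close>
  define P where "P a \<longleftrightarrow> a \<le> i \<and> a \<le> j \<and> level_anc a x = level_anc a y" for a
  have le: "b * D \<le> depth x" if "b \<le> i" for b
    using that by (metis i_def div_times_less_eq_dividend le_trans mult_le_mono1)
  have le': "b * D \<le> depth y" if "b \<le> j" for b
    using that by (metis j_def div_times_less_eq_dividend le_trans mult_le_mono1)
  have "P 0"
    using level_anc_eqI[OF descendants_root, of _ 0] assms by (simp add: P_def)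
  moreover have "\<forall>b. P b \<longrightarrow> b \<le> i" by (simp add: P_def)
  ultimately obtain a where a: "P a" and max: "\<And>b. P b \<Longrightarrow> b \<le> a"
    using GreatestI_nat[of P 0 i] Greatest_le_nat[of P _ i] by metis
  define m n where "m = i - a" and "n = j - a"
  have im: "i = a + m" and jn: "j = a + n" using a by (auto simp: P_def m_def n_def)
  define z where "z = level_anc a x"
  have zy: "z = level_anc a y" using a by (simp add: P_def z_def)
  have zx: "z \<in> V" "depth z = a * D" "x \<in> descendants z" "y \<in> descendants z"
    using level_anc[OF assms(1) le, of a] level_anc[OF assms(2) le', of a] im jn zy
    by (auto simp: z_def)
  let ?x = "level_anc i x" and ?y = "level_anc j y" and ?d = "path_dist (f x) (f y)"
  have x: "?x \<in> V" "depth ?x = i * D" using level_anc[OF assms(1) le, of i] by auto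
  have y: "?y \<in> V" "depth ?y = j * D" using level_anc[OF assms(2) le', of j] by auto
  have fx: "f x = f ?x" and fy: "f y = f ?y"
    using f_level_anc assms by (simp_all add: i_def j_def)
  have xb: "level_anc b ?x = level_anc b x" if "b \<le> i" for b
    using level_anc_level_anc[OF assms(1) le] that by simp
  have yb: "level_anc b ?y = level_anc b y" if "b \<le> j" for b
    using level_anc_level_anc[OF assms(2) le'] that by simp
  have gx: "depth (f z) + m \<le> depth (f x)" "depth (f x) \<le> depth (f z) + m * K"
    using f_iterated_level[OF x(1), of a m] x(2) xb[of a] fx by (simp_all add: im z_def)
  have gy: "depth (f z) + n \<le> depth (f y)" "depth (f y) \<le> depth (f z) + n * K"
    using f_iterated_level[OF y(1), of a n] y(2) yb[of a] fy by (simp_all add: jn zy)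
  have fV: "f x \<in> V" "f y \<in> V" using f_in assms by auto
  have K: "k * K \<le> K" if "k \<le> 1" for k using that mult_le_mono1[of k 1 K] by simp
  \<comment> \<open>If one branch continues for at most one level past \<open>a\<close>, its image
    is at most \<open>K\<close> deeper than \<open>f z\<close>, while the other image is deeper by
    at least its number of levels; the depth difference bounds that number by
    \<open>?d + K\<close>.\<close>
  consider "m \<le> 1" | "n \<le> 1" | "m \<ge> 2" "n \<ge> 2" by linarith
  then have bound: "m + n \<le> ?d + K + 4"
  proof cases
    case 1
    then show ?thesis using gx gy K[OF 1] depth_le_path_dist[OF fV] by linarith
  next
    case 2
    then show ?thesis
      using gx gy K[OF 2] depth_le_path_dist[OF fV(2,1)] path_dist_commute[of "f y" "f x"] by linarith
  next
    case 3
    let ?u = "level_anc (Suc (Suc a)) x" and ?w = "level_anc (Suc (Suc a)) y"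
    have ai: "Suc (Suc a) \<le> i" and aj: "Suc (Suc a) \<le> j" using 3 im jn by auto
    have u: "?u \<in> V" "depth ?u = Suc (Suc a) * D"
      using level_anc[OF assms(1) le[OF ai]] by auto
    have w: "?w \<in> V" "depth ?w = Suc (Suc a) * D"
      using level_anc[OF assms(2) le'[OF aj]] by auto
    have "f ?u \<noteq> f ?w"
    proof
      assume "f ?u = f ?w"
      then have "level_anc (Suc a) ?u = level_anc (Suc a) ?w"
        using level_fibre_same_anc u w by blast
      then have "level_anc (Suc a) x = level_anc (Suc a) y"
        using level_anc_level_anc[OF assms(1) le[OF ai]] level_anc_level_anc[OF assms(2) le'[OF aj]]
        by simp
      then have "P (Suc a)" using ai aj by (simp add: P_def)
      then show False using max by fastforce
    qed
    then have incomparable: "f ?u \<notin> descendants (f ?w)" "f ?w \<notin> descendants (f ?u)"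
      using level_images_antichain u w by metis+
    have "i = Suc (Suc a) + (m - 2)" "j = Suc (Suc a) + (n - 2)"
      using im jn 3 by simp_all
    then have "depth ?x = (Suc (Suc a) + (m - 2)) * D" "depth ?y = (Suc (Suc a) + (n - 2)) * D"
      using x(2) y(2) by metis+
    from f_iterated_level[OF x(1) this(1)] f_iterated_level[OF y(1) this(2)]
    have "f x \<in> descendants (f ?u)" "depth (f ?u) + (m - 2) \<le> depth (f x)"
      "f y \<in> descendants (f ?w)" "depth (f ?w) + (n - 2) \<le> depth (f y)"
      using fx fy xb[OF ai] yb[OF aj] by simp_all
    \<comment> \<open>The images separate at level \<open>a + 2\<close> at the latest, so all but
      two levels of each branch count: \<open>(m - 2) + (n - 2)\<close> is at most
      \<open>?d\<close>. This is the source of the 4.\<close>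
    with path_dist_incomparable[OF this(1,3) incomparable] show ?thesis by linarith
  qed
  have "path_dist x y \<le> path_dist x z + path_dist z y"
    using path_dist_triangle assms zx by blast
  moreover have "depth x = a * D + path_dist x z" "depth y = a * D + path_dist z y"
    using path_dist_descendant[OF zx(3)] path_dist_descendant[OF zx(4)] zx(2)
    by (simp_all add: path_dist_commute[of x])
  \<comment> \<open>Each of \<open>x\<close> and \<open>y\<close> may lie up to one incomplete level
    below its last level ancestor; these two extra levels turn the 4 into 6.\<close>
  moreover have "depth x \<le> i * D + D" "depth y \<le> j * D + D"
    using D_pos dividend_less_div_times[of D "depth x"] dividend_less_div_times[of D "depth y"]
    by (simp_all add: i_def j_def)
  ultimately have "path_dist x y \<le> D * (m + n + 2)"
    by (simp add: im jn algebra_simps)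
  also have "\<dots> \<le> D * (?d + K + 6)"
    using bound by (intro mult_le_mono2) simp
  finally show ?thesis .
qed

lemma quasi_isometry_f:
  "Metric_space.quasi_isometry V (\<lambda>u v. real (path_dist u v)) (real (D + K + 6)) f"
proof -
  let ?C = "real (D + K + 6)"
  have "real (path_dist x y) / ?C - ?C \<le> real (path_dist (f x) (f y))"
    and "real (path_dist (f x) (f y)) \<le> ?C * real (path_dist x y) + ?C"
    if xy: "x \<in> V" "y \<in> V" for x y
  proof -
    let ?d = "path_dist (f x) (f y)"
    have "path_dist x y \<le> D * (?d + K + 6)" by (rule f_lower_bound[OF xy])
    \<comment> \<open>The constant dominates both the factor \<open>D\<close> and the summand
      \<open>K + 6\<close>, so one number serves multiplicatively and additively.\<close>
    also have "\<dots> \<le> (D + K + 6) * (?d + (D + K + 6))" by (intro mult_le_mono) auto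
    finally have "real (path_dist x y) \<le> real ((D + K + 6) * (?d + (D + K + 6)))"
      by (simp only: of_nat_le_iff)
    also have "\<dots> = ?C * (real ?d + ?C)" by simp
    finally have "real (path_dist x y) / ?C \<le> real ?d + ?C"
      by (simp add: pos_divide_le_eq mult.commute)
    then show "real (path_dist x y) / ?C - ?C \<le> real ?d" by linarith
    have "?d \<le> K * path_dist x y" by (rule f_lipschitz[OF xy])
    also have "\<dots> \<le> (D + K + 6) * path_dist x y + (D + K + 6)"
      by (rule trans_le_add1, rule mult_le_mono1) simp
    finally have "real ?d \<le> real ((D + K + 6) * path_dist x y + (D + K + 6))"
      by (simp only: of_nat_le_iff)
    then show "real ?d \<le> ?C * real (path_dist x y) + ?C" by simp
  qed
  moreover have "\<exists>D'. \<forall>y\<in>V. \<exists>x\<in>V. real (path_dist y (f x)) \<le> D'"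
    using f_coarsely_surjective of_nat_mono by (intro exI[of _ "real K"]) blast
  ultimately show ?thesis
    unfolding Metric_space.quasi_isometry_def[OF Metric_space_path_dist] using f_in by auto
qed

end

theorem lemma3p1:
  fixes V :: "'a set" and E :: "'a \<Rightarrow> 'a \<Rightarrow> bool" and v\<^sub>0 :: 'a and \<delta> D :: nat
  assumes "rooted_regular_tree V E \<delta> v\<^sub>0" and "\<delta> \<ge> 3" and "D \<ge> 1"
  shows "\<exists>C::real. \<forall>f. rooted_tree.mixed_subtree_qi V E v\<^sub>0 D f \<longrightarrow>
           rooted_tree.order_preserving V E v\<^sub>0 f \<and>
           Metric_space.quasi_isometry V (\<lambda>u v. real (simple_graph.path_dist V E u v)) C f"
proof -
  interpret rooted_regular_tree V E \<delta> v\<^sub>0 by fact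
  \<comment> \<open>\<open>K\<close> is written out because the constant has to be chosen before
    \<open>f\<close>; only \<open>\<delta>\<close> and \<open>D\<close> enter it.\<close>
  have "order_preserving f \<and> Metric_space.quasi_isometry V (\<lambda>u v. real (path_dist u v))
      (real (D + \<delta> ^ D * \<delta> ^ D + 6)) f" if "mixed_subtree_qi D f" for f
  proof -
    interpret deep_map V E \<delta> v\<^sub>0 D f
      by (rule deep_map_mixed_subtree_qi[OF assms(2,3) that])
    show ?thesis
      using order_preserving_f quasi_isometry_f by (simp add: K_def)
  qed
  then show ?thesis by blast
qed

end
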